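(* Let $\mathsf{L}^\star$ be a logic and $\mathsf{CS}$ a constant specification as in the context, where $\mathsf{CS}$ is required to be axiomatically appropriate in case (jd) is in $\mathsf{L}^\star$ and (jt) is not in $\mathsf{L}^\star$. For every formula $F\in\mathcal{L}_J$: if $\mathcal{M},\omega\Vdash F$ for all $\mathsf{L}^\star_{\mathsf{CS}}$-subset models $\mathcal{M}=(W,W_0,V,E)$ and all $\omega\in W_0$, then $\mathsf{L}^\star_{\mathsf{CS}}\vdash F$.
   Context: Terms $\mathsf{Tm}$: $t::=c_i\mid x_i\mid \mathsf{c}^\star\mid (t+t)\mid\ !t$ ($c_i$ constants, $x_i$ variables, $\mathsf{c}^\star$ special constant). Formulas $\mathcal{L}_J$: $F::=p_i\mid\bot\mid F\to F\mid t:F$. The $\mathsf{c}^\star$-terms: $\mathsf{c}^\star$ is one, and if $c$ is one and $s,t$ are any terms then $s+c$ and $c+t$ are. Axiom schemes: (cl) all classical propositional axioms; (j+) $s:A\lor t:A\to(s+t):A$; (jc$^\star$) $c:A\land c:(A\to B)\to c:B$ for $\mathsf{c}^\star$-terms $c$; (j4) $t:A\to\ !t:(t:A)$; (jd) $t:\bot\to\bot$; (jt) $t:A\to A$. A logic $\mathsf{L}^\star$: (cl),(j+),(jc$^\star$) plus some subset of $\{$(j4),(jd),(jt)$\}$. A constant specification $\mathsf{CS}$: set of pairs $(c,A)$, $c$ a constant, $A$ an axiom of $\mathsf{L}^\star$; axiomatically appropriate if for each axiom $A$ there is $c$ with $(c,A)\in\mathsf{CS}$. $\mathsf{L}^\star_{\mathsf{CS}}$: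 Hilbert system with these axioms, modus ponens and axiom necessitation (for $(c,A)\in\mathsf{CS}$, $n\ge0$ infer $!^nc:\,!^{n-1}c:\cdots:\,!c:c:A$, $!^kc$ being $c$ preceded by $k$ copies of $!$). An $\mathsf{L}^\star_{\mathsf{CS}}$-subset model is $\mathcal{M}=(W,W_0,V,E)$ with $W$ a set, $\emptyset\neq W_0\subseteq W$, $V:W\times\mathcal{L}_J\to\{0,1\}$, $E:W\times\mathsf{Tm}\to\mathcal{P}(W)$ such that, with $[A]=\{\upsilon:V(\upsilon,A)=1\}$ and $W_{MP}=\{\upsilon\in W:$ for all $A,B$, $V(\upsilon,A)=V(\upsilon,A\to B)=1$ implies $V(\upsilon,B)=1\}$, for all $\omega\in W_0$, $s,t$, $F,G$: $V(\omega,\bot)=0$; $V(\omega,F\to G)=1$ iff $V(\omega,F)=0$ or $V(\omega,G)=1$; $V(\omega,t:F)=1$ iff $E(\omega,t)\subseteq[F]$; $E(\omega,s+t)\subseteq E(\omega,s)\cap E(\omega,t)$; $E(\omega,\mathsf{c}^\star)\subseteq W_{MP}$; if (jd)$\in\mathsf{L}^\star$ some $\upsilon\in W_0$ is in $E(\omega,t)$; if (jt)$\in\mathsf{L}^\star$ then $\omega\in E(\omega,t)$; if (j4)$\in\mathsf{L}^\star$ then $E(\omega,!t)\subseteq\{\upsilon:\forall F\,(V(\omega,t:F)=1\Rightarrow V(\upsilon,t:F)=1)\}$; for $(c,A)\in\mathsf{CS}$, $n\ge1$: $E(\omega,c)\subseteq[A]$ and $E(\omega,!^nc)\subseteq[!^{n-1}c:\cdots:\,!c:c:A]$.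 Truth: $\mathcal{M},\omega\Vdash F$ iff $V(\omega,F)=1$. *)

theory Defs
  imports Main
begin

datatype tm =
    Cst nat
  | Var nat
  | CStar  (\<open>\<^bold>c\<^bold>\<star>\<close>)
  | Plus tm tm  (infixl \<open>\<^bold>+\<close> 75)
  | Bang tm  (\<open>\<^bold>! _\<close> [80] 80)

datatype fm =
    Prop nat
  | Bot  (\<open>\<^bold>\<bottom>\<close>)
  | Imp fm fm  (infixr \<open>\<^bold>\<rightarrow>\<close> 60)
  | Just tm fm  (infixr \<open>\<^bold>:\<close> 70)

text \<open>Negation, disjunction and conjunction are the usual abbreviations in terms of
  implication and falsum.\<close>

abbreviation Neg :: "fm \<Rightarrow> fm"  (\<open>\<^bold>\<not> _\<close> [68] 68)
  where "\<^bold>\<not> A \<equiv> A \<^bold>\<rightarrow> \<^bold>\<bottom>"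

abbreviation Dis :: "fm \<Rightarrow> fm \<Rightarrow> fm"  (infixr \<open>\<^bold>\<or>\<close> 64)
  where "A \<^bold>\<or> B \<equiv> \<^bold>\<not> A \<^bold>\<rightarrow> B"

abbreviation Con :: "fm \<Rightarrow> fm \<Rightarrow> fm"  (infixr \<open>\<^bold>\<and>\<close> 66)
  where "A \<^bold>\<and> B \<equiv> \<^bold>\<not> (A \<^bold>\<rightarrow> \<^bold>\<not> B)"

inductive cstar_term :: "tm \<Rightarrow> bool" where
  "cstar_term \<^bold>c\<^bold>\<star>"
| "cstar_term c \<Longrightarrow> cstar_term (s \<^bold>+ c)"
| "cstar_term c \<Longrightarrow> cstar_term (c \<^bold>+ t)"

text \<open>Scheme (cl) consists of all instances of classical propositional tautologies:
  the formulas true under every Boolean valuation in which propositional letters and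
  formulas of the form \<open>t \<^bold>: A\<close> are treated as atoms.\<close>

primrec bool_eval :: "(fm \<Rightarrow> bool) \<Rightarrow> fm \<Rightarrow> bool" where
  "bool_eval v (Prop i) = v (Prop i)"
| "bool_eval v \<^bold>\<bottom> = False"
| "bool_eval v (A \<^bold>\<rightarrow> B) = (bool_eval v A \<longrightarrow> bool_eval v B)"
| "bool_eval v (t \<^bold>: A) = v (t \<^bold>: A)"

definition tautology :: "fm \<Rightarrow> bool" where
  "tautology A \<longleftrightarrow> (\<forall>v. bool_eval v A)"

text \<open>A logic is given by its set of optional schemes.\<close>

datatype scheme = J4 | JD | JT

inductive is_axiom :: "scheme set \<Rightarrow> fm \<Rightarrow> bool" for L :: "scheme set" where
  cl: "tautology A \<Longrightarrow> is_axiom L A"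
| jplus: "is_axiom L (s \<^bold>: A \<^bold>\<or> t \<^bold>: A \<^bold>\<rightarrow> (s \<^bold>+ t) \<^bold>: A)"
| jcstar: "cstar_term c \<Longrightarrow> is_axiom L (c \<^bold>: A \<^bold>\<and> c \<^bold>: (A \<^bold>\<rightarrow> B) \<^bold>\<rightarrow> c \<^bold>: B)"
| j4: "J4 \<in> L \<Longrightarrow> is_axiom L (t \<^bold>: A \<^bold>\<rightarrow> \<^bold>! t \<^bold>: (t \<^bold>: A))"
| jd: "JD \<in> L \<Longrightarrow> is_axiom L (t \<^bold>: \<^bold>\<bottom> \<^bold>\<rightarrow> \<^bold>\<bottom>)"
| jt: "JT \<in> L \<Longrightarrow> is_axiom L (t \<^bold>: A \<^bold>\<rightarrow> A)"

text \<open>A pair \<open>(i, A)\<close> of a constant specification stands for \<open>(Cst i, A)\<close>; in particular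
  the special constant does not occur in it.\<close>

definition constant_specification :: "scheme set \<Rightarrow> (nat \<times> fm) set \<Rightarrow> bool" where
  "constant_specification L CS \<longleftrightarrow> (\<forall>(i, A) \<in> CS. is_axiom L A)"

definition axiomatically_appropriate :: "scheme set \<Rightarrow> (nat \<times> fm) set \<Rightarrow> bool" where
  "axiomatically_appropriate L CS \<longleftrightarrow> (\<forall>A. is_axiom L A \<longrightarrow> (\<exists>i. (i, A) \<in> CS))"

definition bangs :: "nat \<Rightarrow> tm \<Rightarrow> tm" where
  "bangs n t = (Bang ^^ n) t"

text \<open>\<open>tower n t A\<close> is \<open>!\<^sup>n t : !\<^sup>n\<^sup>-\<^sup>1 t : \<dots> : !t : t : A\<close>; it has \<open>n + 1\<close> prefixed terms.\<close>

primrec tower :: "nat \<Rightarrow> tm \<Rightarrow> fm \<Rightarrow> fm" where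
  "tower 0 t A = t \<^bold>: A"
| "tower (Suc n) t A = bangs (Suc n) t \<^bold>: tower n t A"

inductive derivable :: "scheme set \<Rightarrow> (nat \<times> fm) set \<Rightarrow> fm \<Rightarrow> bool"
  (\<open>_, _ \<turnstile> _\<close> [50, 50, 50] 50)
  for L :: "scheme set" and CS :: "(nat \<times> fm) set" where
  ax: "is_axiom L A \<Longrightarrow> L, CS \<turnstile> A"
| mp: "L, CS \<turnstile> A \<Longrightarrow> L, CS \<turnstile> A \<^bold>\<rightarrow> B \<Longrightarrow> L, CS \<turnstile> B"
| an: "(i, A) \<in> CS \<Longrightarrow> L, CS \<turnstile> tower n (Cst i) A"

definition truth_set :: "'w set \<Rightarrow> ('w \<Rightarrow> fm \<Rightarrow> bool) \<Rightarrow> fm \<Rightarrow> 'w set" where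
  "truth_set W V A = {\<upsilon> \<in> W. V \<upsilon> A}"

definition W_MP :: "'w set \<Rightarrow> ('w \<Rightarrow> fm \<Rightarrow> bool) \<Rightarrow> 'w set" where
  "W_MP W V = {\<upsilon> \<in> W. \<forall>A B. V \<upsilon> A \<and> V \<upsilon> (A \<^bold>\<rightarrow> B) \<longrightarrow> V \<upsilon> B}"

text \<open>\<open>V\<close> and \<open>E\<close> are functions on \<open>W\<close>; their values outside \<open>W\<close> are irrelevant.\<close>

locale subset_model =
  fixes L :: "scheme set"
    and CS :: "(nat \<times> fm) set"
    and W W\<^sub>0 :: "'w set"
    and V :: "'w \<Rightarrow> fm \<Rightarrow> bool"
    and E :: "'w \<Rightarrow> tm \<Rightarrow> 'w set"
  assumes normal_nonempty: "W\<^sub>0 \<noteq> {}"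
    and normal_subset: "W\<^sub>0 \<subseteq> W"
    and E_subset: "\<omega> \<in> W \<Longrightarrow> E \<omega> t \<subseteq> W"
    and V_Bot: "\<omega> \<in> W\<^sub>0 \<Longrightarrow> \<not> V \<omega> \<^bold>\<bottom>"
    and V_Imp: "\<omega> \<in> W\<^sub>0 \<Longrightarrow> V \<omega> (F \<^bold>\<rightarrow> G) \<longleftrightarrow> \<not> V \<omega> F \<or> V \<omega> G"
    and V_Just: "\<omega> \<in> W\<^sub>0 \<Longrightarrow> V \<omega> (t \<^bold>: F) \<longleftrightarrow> E \<omega> t \<subseteq> truth_set W V F"
    and E_Plus: "\<omega> \<in> W\<^sub>0 \<Longrightarrow> E \<omega> (s \<^bold>+ t) \<subseteq> E \<omega> s \<inter> E \<omega> t"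
    and E_CStar: "\<omega> \<in> W\<^sub>0 \<Longrightarrow> E \<omega> \<^bold>c\<^bold>\<star> \<subseteq> W_MP W V"
    and E_jd: "JD \<in> L \<Longrightarrow> \<omega> \<in> W\<^sub>0 \<Longrightarrow> \<exists>\<upsilon>\<in>W\<^sub>0. \<upsilon> \<in> E \<omega> t"
    and E_jt: "JT \<in> L \<Longrightarrow> \<omega> \<in> W\<^sub>0 \<Longrightarrow> \<omega> \<in> E \<omega> t"
    and E_j4: "J4 \<in> L \<Longrightarrow> \<omega> \<in> W\<^sub>0 \<Longrightarrow>
      E \<omega> (\<^bold>! t) \<subseteq> {\<upsilon> \<in> W. \<forall>F. V \<omega> (t \<^bold>: F) \<longrightarrow> V \<upsilon> (t \<^bold>: F)}"
    and E_CS: "\<omega> \<in> W\<^sub>0 \<Longrightarrow> (i, A) \<in> CS \<Longrightarrow> E \<omega> (Cst i) \<subseteq> truth_set W V A"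
    and E_CS_bangs: "\<omega> \<in> W\<^sub>0 \<Longrightarrow> (i, A) \<in> CS \<Longrightarrow> 1 \<le> n \<Longrightarrow>
      E \<omega> (bangs n (Cst i)) \<subseteq> truth_set W V (tower (n - 1) (Cst i) A)"

text \<open>A formula of HOL cannot quantify over the type of worlds. \<open>valid\<close> therefore ranges
  over all models whose worlds are drawn from the type \<^typ>\<open>fm set\<close>. Truth in
  all subset models whatsoever implies \<open>valid\<close>, so using \<open>valid\<close> as the hypothesis of a
  completeness theorem only makes that hypothesis weaker.\<close>

definition valid :: "scheme set \<Rightarrow> (nat \<times> fm) set \<Rightarrow> fm \<Rightarrow> bool" where
  "valid L CS F \<longleftrightarrow>
    (\<forall>(W :: fm set set) W\<^sub>0 V E. subset_model L CS W W\<^sub>0 V E \<longrightarrow> (\<forall>\<omega>\<in>W\<^sub>0. V \<omega> F))"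

end

theory Submission
  imports Defs
begin

text \<open>The worlds of the canonical model are all sets of formulas, and the normal ones are the
  maximal consistent sets. A term \<open>t\<close> leads from \<open>\<Gamma>\<close> to the supersets of
  \<open>unjust \<Gamma> t = {A. t : A \<in> \<Gamma>}\<close>, restricted to those closed under modus ponens if \<open>t\<close> is a
  \<open>c\<star>\<close>-term; the set \<open>unjust \<Gamma> t\<close> is itself among them and refutes every \<open>A\<close> with
  \<open>t : A \<notin> \<Gamma>\<close>. For (jd) without (jt) one needs \<open>unjust \<Gamma> t\<close> to be consistent: by axiomatic
  appropriateness theorems are justified by terms, and \<open>s : A\<close>, \<open>s' : (A \<rightarrow> B)\<close> give
  \<open>(s + s' + c\<star>) : B\<close>, so an inconsistency would put some \<open>s : \<bottom>\<close> into \<open>\<Gamma>\<close>.\<close>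

section \<open>Deduction from hypotheses\<close>

text \<open>Axioms and necessitation instances have no premises, so all theorems enter together
  through \<open>derived\<close>. Modus ponens is the only rule left, and the deduction theorem
  follows without side conditions.\<close>

inductive ded :: "scheme set \<Rightarrow> (nat \<times> fm) set \<Rightarrow> fm set \<Rightarrow> fm \<Rightarrow> bool"
  for L CS \<Gamma> where
  hyp: "A \<in> \<Gamma> \<Longrightarrow> ded L CS \<Gamma> A"
| derived: "L, CS \<turnstile> A \<Longrightarrow> ded L CS \<Gamma> A"
| mp: "ded L CS \<Gamma> A \<Longrightarrow> ded L CS \<Gamma> (A \<^bold>\<rightarrow> B) \<Longrightarrow> ded L CS \<Gamma> B"

lemma ded_axiom: "is_axiom L A \<Longrightarrow> ded L CS \<Gamma> A"
  by (blast intro: ded.derived derivable.ax)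

lemma ded_tautology: "tautology A \<Longrightarrow> ded L CS \<Gamma> A"
  by (blast intro: ded_axiom is_axiom.cl)

lemma ded_mono: "ded L CS \<Gamma> A \<Longrightarrow> \<Gamma> \<subseteq> \<Delta> \<Longrightarrow> ded L CS \<Delta> A"
  by (induction rule: ded.induct) (auto intro: ded.intros)

lemma ded_empty: "ded L CS {} A \<Longrightarrow> L, CS \<turnstile> A"
  by (induction rule: ded.induct) (auto intro: derivable.mp)

lemma ded_weaken: "ded L CS \<Gamma> B \<Longrightarrow> ded L CS \<Gamma> (A \<^bold>\<rightarrow> B)"
  by (rule ded.mp[of _ _ _ B], assumption, rule ded_tautology) (simp add: tautology_def)

lemma deduction_theorem:
  assumes "ded L CS (insert A \<Gamma>) B"
  shows "ded L CS \<Gamma> (A \<^bold>\<rightarrow> B)"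
  using assms
proof (induction rule: ded.induct)
  case (hyp B)
  then show ?case
    by (cases "B = A") (auto simp: tautology_def intro: ded_tautology ded_weaken ded.hyp)
next
  case (derived B)
  then show ?case by (blast intro: ded_weaken ded.derived)
next
  case (mp B C)
  have "ded L CS \<Gamma> ((A \<^bold>\<rightarrow> B) \<^bold>\<rightarrow> (A \<^bold>\<rightarrow> B \<^bold>\<rightarrow> C) \<^bold>\<rightarrow> A \<^bold>\<rightarrow> C)"
    by (rule ded_tautology) (simp add: tautology_def)
  with mp.IH show ?case by (blast intro: ded.mp)
qed

text \<open>The two premises of a modus ponens step come from comparable members of the chain, and
  the larger one yields both. Nonemptiness supplies a member in the case of a theorem.\<close>

lemma ded_Union_chain:
  assumes "ded L CS (\<Union>C) A" "subset.chain S C" "C \<noteq> {}"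
  shows "\<exists>\<Gamma>\<in>C. ded L CS \<Gamma> A"
  using assms(1)
proof (induction rule: ded.induct)
  case (hyp A)
  then show ?case by (blast intro: ded.hyp)
next
  case (derived A)
  then show ?case using assms(3) by (blast intro: ded.derived)
next
  case (mp A B)
  then obtain \<Gamma> \<Delta> where "\<Gamma> \<in> C" "\<Delta> \<in> C" "ded L CS \<Gamma> A" "ded L CS \<Delta> (A \<^bold>\<rightarrow> B)"
    by blast
  moreover from this assms(2) have "\<Gamma> \<subseteq> \<Delta> \<or> \<Delta> \<subseteq> \<Gamma>"
    by (auto simp: subset.chain_def)
  ultimately show ?case by (meson ded.mp ded_mono)
qed

section \<open>Maximal consistent sets\<close>

definition consistent :: "scheme set \<Rightarrow> (nat \<times> fm) set \<Rightarrow> fm set \<Rightarrow> bool" where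
  "consistent L CS \<Gamma> \<longleftrightarrow> \<not> ded L CS \<Gamma> \<^bold>\<bottom>"

definition maximal_consistent :: "scheme set \<Rightarrow> (nat \<times> fm) set \<Rightarrow> fm set \<Rightarrow> bool" where
  "maximal_consistent L CS \<Gamma> \<longleftrightarrow>
    consistent L CS \<Gamma> \<and> (\<forall>A. consistent L CS (insert A \<Gamma>) \<longrightarrow> A \<in> \<Gamma>)"

lemma lindenbaum:
  assumes "consistent L CS \<Gamma>"
  obtains \<Delta> where "\<Gamma> \<subseteq> \<Delta>" "maximal_consistent L CS \<Delta>"
proof -
  let ?S = "{\<Delta>. \<Gamma> \<subseteq> \<Delta> \<and> consistent L CS \<Delta>}"
  \<comment> \<open>Upper bounds for Zorn's lemma: falsum deduced from the union would already be
    deducible from one member of the chain.\<close>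
  have "\<Union>C \<in> ?S" if "C \<noteq> {}" "subset.chain ?S C" for C
  proof -
    from that have "\<Gamma> \<subseteq> \<Union>C" by (fastforce simp: subset.chain_def)
    moreover from that have "\<forall>\<Delta>\<in>C. \<not> ded L CS \<Delta> \<^bold>\<bottom>"
      by (auto simp: subset.chain_def consistent_def)
    with that have "\<not> ded L CS (\<Union>C) \<^bold>\<bottom>" by (blast dest: ded_Union_chain)
    ultimately show ?thesis by (simp add: consistent_def)
  qed
  moreover have "?S \<noteq> {}" using assms by blast
  ultimately obtain \<Delta> where \<Delta>: "\<Delta> \<in> ?S" "\<And>\<Theta>. \<Theta> \<in> ?S \<Longrightarrow> \<Delta> \<subseteq> \<Theta> \<Longrightarrow> \<Theta> = \<Delta>"
    using subset_Zorn_nonempty[of ?S] by (auto 0 4)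
  have "A \<in> \<Delta>" if "consistent L CS (insert A \<Delta>)" for A
    using \<Delta>(1) \<Delta>(2)[of "insert A \<Delta>"] that by blast
  with \<Delta>(1) have "maximal_consistent L CS \<Delta>" by (simp add: maximal_consistent_def)
  with \<Delta>(1) show thesis using that by blast
qed

context
  fixes L CS \<Gamma>
  assumes \<Gamma>: "maximal_consistent L CS \<Gamma>"
begin

lemma maximal_consistent_Bot: "\<^bold>\<bottom> \<notin> \<Gamma>"
  using \<Gamma> by (auto simp: maximal_consistent_def consistent_def intro: ded.hyp)

text \<open>By maximality, adding \<open>A\<close> is inconsistent, and the deduction theorem
  discharges \<open>A\<close>.\<close>

lemma maximal_consistent_Neg: "A \<notin> \<Gamma> \<Longrightarrow> ded L CS \<Gamma> (\<^bold>\<not> A)"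
  using \<Gamma> by (auto simp: maximal_consistent_def consistent_def intro: deduction_theorem)

lemma maximal_consistent_ded: "ded L CS \<Gamma> A \<Longrightarrow> A \<in> \<Gamma>"
  using \<Gamma> maximal_consistent_Neg
  by (auto simp: maximal_consistent_def consistent_def intro: ded.mp)

lemma maximal_consistent_axiom: "is_axiom L A \<Longrightarrow> A \<in> \<Gamma>"
  by (blast intro: maximal_consistent_ded ded_axiom)

lemma maximal_consistent_mp: "A \<in> \<Gamma> \<Longrightarrow> A \<^bold>\<rightarrow> B \<in> \<Gamma> \<Longrightarrow> B \<in> \<Gamma>"
  by (blast intro: maximal_consistent_ded ded.intros)

lemma maximal_consistent_Imp: "A \<^bold>\<rightarrow> B \<in> \<Gamma> \<longleftrightarrow> A \<notin> \<Gamma> \<or> B \<in> \<Gamma>"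
proof
  show "A \<^bold>\<rightarrow> B \<in> \<Gamma> \<Longrightarrow> A \<notin> \<Gamma> \<or> B \<in> \<Gamma>"
    using maximal_consistent_mp by blast
next
  assume "A \<notin> \<Gamma> \<or> B \<in> \<Gamma>"
  then show "A \<^bold>\<rightarrow> B \<in> \<Gamma>"
  proof
    assume "A \<notin> \<Gamma>"
    moreover have "ded L CS \<Gamma> (\<^bold>\<not> A \<^bold>\<rightarrow> A \<^bold>\<rightarrow> B)"
      by (rule ded_tautology) (simp add: tautology_def)
    ultimately show ?thesis
      by (blast intro: maximal_consistent_ded maximal_consistent_Neg ded.mp)
  next
    assume "B \<in> \<Gamma>"
    then show ?thesis by (blast intro: maximal_consistent_ded ded_weaken ded.hyp)
  qed
qed

lemma maximal_consistent_Plus: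
  assumes "s \<^bold>: A \<in> \<Gamma> \<or> t \<^bold>: A \<in> \<Gamma>"
  shows "(s \<^bold>+ t) \<^bold>: A \<in> \<Gamma>"
  using maximal_consistent_axiom[OF is_axiom.jplus, of s A t] assms maximal_consistent_Bot
  by (auto simp: maximal_consistent_Imp)

lemma maximal_consistent_cstar:
  assumes "cstar_term c" "c \<^bold>: A \<in> \<Gamma>" "c \<^bold>: (A \<^bold>\<rightarrow> B) \<in> \<Gamma>"
  shows "c \<^bold>: B \<in> \<Gamma>"
  using maximal_consistent_axiom[OF is_axiom.jcstar[OF assms(1)], of A B] assms(2,3)
    maximal_consistent_Bot
  by (auto simp: maximal_consistent_Imp)

text \<open>Terms have no application operator; summing with \<open>CStar\<close> replaces it. By
  (j+) the sum justifies whatever \<open>s\<close> and \<open>t\<close> justify, and being a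
  c\<star>-term it obeys (jc\<star>).\<close>

lemma maximal_consistent_app:
  assumes "s \<^bold>: A \<in> \<Gamma>" "t \<^bold>: (A \<^bold>\<rightarrow> B) \<in> \<Gamma>"
  shows "(s \<^bold>+ t \<^bold>+ \<^bold>c\<^bold>\<star>) \<^bold>: B \<in> \<Gamma>"
  by (rule maximal_consistent_cstar[where A = A])
    (use assms in \<open>auto intro: cstar_term.intros maximal_consistent_Plus\<close>)

text \<open>A constant justifies each axiom, \<open>maximal_consistent_app\<close> handles modus
  ponens, and a necessitation instance is justified by the next level of its tower.\<close>

lemma internalization:
  assumes "axiomatically_appropriate L CS" "L, CS \<turnstile> A"
  shows "\<exists>s. s \<^bold>: A \<in> \<Gamma>"
  using assms(2)
proof (induction rule: derivable.induct)
  case (ax A)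
  then obtain i where "(i, A) \<in> CS"
    using assms(1) by (auto simp: axiomatically_appropriate_def)
  then show ?case
    using derivable.an[of i A CS L 0] by (auto intro: maximal_consistent_ded ded.derived)
next
  case (mp A B)
  then show ?case by (blast intro: maximal_consistent_app)
next
  case (an i A n)
  then show ?case
    using derivable.an[of i A CS L "Suc n"] by (auto intro: maximal_consistent_ded ded.derived)
qed

end

section \<open>The canonical model\<close>

definition unjust :: "fm set \<Rightarrow> tm \<Rightarrow> fm set" where
  "unjust \<Gamma> t = {A. t \<^bold>: A \<in> \<Gamma>}"

lemma consistent_unjust:
  assumes "maximal_consistent L CS \<Gamma>" "JD \<in> L" "axiomatically_appropriate L CS"
  shows "consistent L CS (unjust \<Gamma> t)"
proof -
  \<comment> \<open>The term \<open>s\<close> is left free because every modus ponens step enlarges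
    it; this is harmless, since (jd) covers all terms.\<close>
  have "\<exists>s. s \<^bold>: A \<in> \<Gamma>" if "ded L CS (unjust \<Gamma> t) A" for A
    using that
  proof (induction rule: ded.induct)
    case (hyp A)
    then show ?case by (auto simp: unjust_def)
  next
    case (derived A)
    then show ?case using internalization assms by blast
  next
    case (mp A B)
    then show ?case using maximal_consistent_app assms(1) by blast
  qed
  moreover have "s \<^bold>: \<^bold>\<bottom> \<notin> \<Gamma>" for s
    using maximal_consistent_axiom[OF assms(1) is_axiom.jd[OF assms(2), of s]] assms(1)
    by (blast dest: maximal_consistent_mp maximal_consistent_Bot)
  ultimately show ?thesis unfolding consistent_def by blast
qed

text \<open>Closure under modus ponens is imposed for all c\<star>-terms, not just
  \<open>CStar\<close>: the condition on sums passes it on from either summand.\<close>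

definition canonical_E :: "fm set \<Rightarrow> tm \<Rightarrow> fm set set" where
  "canonical_E \<Gamma> t =
    {\<Delta>. unjust \<Gamma> t \<subseteq> \<Delta> \<and> (cstar_term t \<longrightarrow> \<Delta> \<in> W_MP UNIV (\<lambda>\<Delta> A. A \<in> \<Delta>))}"

text \<open>For a c\<star>-term \<open>t\<close>, (jc\<star>) says exactly that
  \<open>unjust \<Gamma> t\<close> is closed under modus ponens.\<close>

lemma unjust_in_canonical_E:
  "maximal_consistent L CS \<Gamma> \<Longrightarrow> unjust \<Gamma> t \<in> canonical_E \<Gamma> t"
  by (auto simp: canonical_E_def unjust_def W_MP_def intro: maximal_consistent_cstar)

lemma maximal_consistent_in_canonical_E:
  "maximal_consistent L CS \<Delta> \<Longrightarrow> unjust \<Gamma> t \<subseteq> \<Delta> \<Longrightarrow> \<Delta> \<in> canonical_E \<Gamma> t"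
  by (auto simp: canonical_E_def W_MP_def intro: maximal_consistent_mp)

lemma maximal_consistent_self_canonical_E:
  assumes "maximal_consistent L CS \<Gamma>" "JT \<in> L"
  shows "\<Gamma> \<in> canonical_E \<Gamma> t"
proof (rule maximal_consistent_in_canonical_E[OF assms(1)])
  show "unjust \<Gamma> t \<subseteq> \<Gamma>"
    using maximal_consistent_axiom[OF assms(1) is_axiom.jt[OF assms(2), of t]]
      maximal_consistent_mp[OF assms(1)]
    by (auto simp: unjust_def)
qed

lemma canonical_E_subset_truth_set:
  assumes "maximal_consistent L CS \<Gamma>"
  shows "canonical_E \<Gamma> t \<subseteq> truth_set UNIV (\<lambda>\<Delta> A. A \<in> \<Delta>) A \<longleftrightarrow> t \<^bold>: A \<in> \<Gamma>"
  using unjust_in_canonical_E[OF assms, of t]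
  by (auto simp: truth_set_def canonical_E_def unjust_def)

text \<open>With (jt) the world \<open>\<Gamma>\<close> itself serves; otherwise a Lindenbaum
  extension of \<open>unjust \<Gamma> t\<close> does.\<close>

lemma canonical_E_exists_maximal_consistent:
  assumes "maximal_consistent L CS \<Gamma>" "JD \<in> L"
    and "JT \<notin> L \<longrightarrow> axiomatically_appropriate L CS"
  shows "\<exists>\<Delta>\<in>Collect (maximal_consistent L CS). \<Delta> \<in> canonical_E \<Gamma> t"
proof (cases "JT \<in> L")
  case True
  with assms(1) show ?thesis by (auto intro: maximal_consistent_self_canonical_E)
next
  case False
  with assms have "consistent L CS (unjust \<Gamma> t)" by (blast intro: consistent_unjust)
  then obtain \<Delta> where "unjust \<Gamma> t \<subseteq> \<Delta>" "maximal_consistent L CS \<Delta>"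
    by (rule lindenbaum)
  then show ?thesis by (auto intro: maximal_consistent_in_canonical_E)
qed

text \<open>The set \<open>\<Gamma>\<^sub>0\<close> makes the set of normal worlds nonempty.\<close>

lemma canonical_model:
  assumes "maximal_consistent L CS \<Gamma>\<^sub>0"
    and "JD \<in> L \<and> JT \<notin> L \<longrightarrow> axiomatically_appropriate L CS"
  shows "subset_model L CS UNIV (Collect (maximal_consistent L CS)) (\<lambda>\<Gamma> A. A \<in> \<Gamma>) canonical_E"
    (is "subset_model _ _ _ ?W\<^sub>0 ?V _")
proof
  show "?W\<^sub>0 \<noteq> {}" using assms(1) by blast
  show "?W\<^sub>0 \<subseteq> UNIV" by simp
  show "canonical_E \<Gamma> t \<subseteq> UNIV" for \<Gamma> t by simp
  fix \<Gamma> assume "\<Gamma> \<in> ?W\<^sub>0"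
  then have \<Gamma>: "maximal_consistent L CS \<Gamma>" by simp
  show "\<^bold>\<bottom> \<notin> \<Gamma>"
    by (rule maximal_consistent_Bot[OF \<Gamma>])
  show "F \<^bold>\<rightarrow> G \<in> \<Gamma> \<longleftrightarrow> F \<notin> \<Gamma> \<or> G \<in> \<Gamma>" for F G
    by (rule maximal_consistent_Imp[OF \<Gamma>])
  show "t \<^bold>: F \<in> \<Gamma> \<longleftrightarrow> canonical_E \<Gamma> t \<subseteq> truth_set UNIV ?V F" for t F
    using canonical_E_subset_truth_set[OF \<Gamma>] by blast
  \<comment> \<open>By (j+), \<open>unjust\<close> of the sum contains \<open>unjust\<close> of each
    summand, so fewer worlds lie above it.\<close>
  show "canonical_E \<Gamma> (s \<^bold>+ t) \<subseteq> canonical_E \<Gamma> s \<inter> canonical_E \<Gamma> t" for s t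
    by (auto simp: canonical_E_def unjust_def
        intro: cstar_term.intros dest: maximal_consistent_Plus[OF \<Gamma>, OF disjI1]
        maximal_consistent_Plus[OF \<Gamma>, OF disjI2])
  show "canonical_E \<Gamma> \<^bold>c\<^bold>\<star> \<subseteq> W_MP UNIV ?V"
    by (auto simp: canonical_E_def intro: cstar_term.intros)
  show "\<exists>\<Delta>\<in>?W\<^sub>0. \<Delta> \<in> canonical_E \<Gamma> t" if "JD \<in> L" for t
    using canonical_E_exists_maximal_consistent[OF \<Gamma> that] that assms(2) by blast
  show "\<Gamma> \<in> canonical_E \<Gamma> t" if "JT \<in> L" for t
    by (rule maximal_consistent_self_canonical_E[OF \<Gamma> that])
  \<comment> \<open>If \<open>\<Gamma>\<close> justifies \<open>F\<close> by \<open>t\<close>, then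
    (j4) puts that very formula into \<open>unjust\<close> of \<open>\<Gamma>\<close> at the banged
    term, hence into \<Delta>.\<close>
  show "canonical_E \<Gamma> (\<^bold>! t) \<subseteq> {\<Delta> \<in> UNIV. \<forall>F. t \<^bold>: F \<in> \<Gamma> \<longrightarrow> t \<^bold>: F \<in> \<Delta>}"
    if "J4 \<in> L" for t
    using maximal_consistent_axiom[OF \<Gamma> is_axiom.j4[OF that, of t]]
      maximal_consistent_mp[OF \<Gamma>]
    by (auto simp: canonical_E_def unjust_def)
  fix i A assume "(i, A) \<in> CS"
  then have tower: "tower n (Cst i) A \<in> \<Gamma>" for n
    by (blast intro: maximal_consistent_ded[OF \<Gamma>] ded.derived derivable.an)
  show "canonical_E \<Gamma> (Cst i) \<subseteq> truth_set UNIV ?V A"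
    using tower[of 0] by (simp add: canonical_E_subset_truth_set[OF \<Gamma>])
  \<comment> \<open>For positive \<open>n\<close>, level \<open>n\<close> of the tower is
    \<open>bangs n (Cst i)\<close> prefixed to level \<open>n - 1\<close>.\<close>
  show "canonical_E \<Gamma> (bangs n (Cst i)) \<subseteq> truth_set UNIV ?V (tower (n - 1) (Cst i) A)"
    if "1 \<le> n" for n
    using tower[of n] that by (cases n) (simp_all add: canonical_E_subset_truth_set[OF \<Gamma>])
qed

section \<open>Completeness by contraposition\<close>

theorem mainTheorem6:
  fixes L :: "scheme set" and CS :: "(nat \<times> fm) set" and F :: fm
  assumes "constant_specification L CS"
    and "JD \<in> L \<and> JT \<notin> L \<longrightarrow> axiomatically_appropriate L CS"
    and "valid L CS F"
  shows "L, CS \<turnstile> F"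
proof (rule ccontr)
  assume *: "\<not> L, CS \<turnstile> F"
  have "consistent L CS {\<^bold>\<not> F}"
    unfolding consistent_def
  proof
    assume "ded L CS {\<^bold>\<not> F} \<^bold>\<bottom>"
    then have "ded L CS {} (\<^bold>\<not> \<^bold>\<not> F)" by (rule deduction_theorem)
    moreover have "ded L CS {} (\<^bold>\<not> \<^bold>\<not> F \<^bold>\<rightarrow> F)"
      by (rule ded_tautology) (simp add: tautology_def)
    ultimately show False using * by (blast intro: ded.mp ded_empty)
  qed
  then obtain \<Gamma> where \<Gamma>: "{\<^bold>\<not> F} \<subseteq> \<Gamma>" "maximal_consistent L CS \<Gamma>"
    by (rule lindenbaum)
  \<comment> \<open>Validity applies to the canonical model, whose worlds have the type over which
    \<open>valid\<close> ranges; \<open>\<Gamma>\<close> then contains \<open>F\<close> along with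
    its negation.\<close>
  then have "F \<in> \<Gamma>"
    using assms(3) canonical_model[OF \<Gamma>(2) assms(2)] unfolding valid_def by blast
  with \<Gamma> show False
    by (auto dest: maximal_consistent_mp maximal_consistent_Bot)
qed

end
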